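(* Let $a,z_0,\dots,z_n$ be given points in $\mathbb{D}$. Suppose that $f\in\mathrm{H}(\mathbb{D})$ is not a Blaschke product of degree at most $n$. Put $f_j(z)=f_j(z;z_{j-1},\dots,z_0)$, $\gamma_j=f_j(z_j)$ and $\tau_j=[a,z_j]$ for $j=0,1,\dots,n$. Then the chain of inequalities $$|f(a)|\le(T_0\circ\cdots\circ T_n)(1)\le\cdots\le(T_0\circ T_1)(1)\le T_0(1)$$ holds, where $T_j$ are the functions defined by $$T_j(x)=\frac{|\tau_j|x+|\gamma_j|}{1+|\tau_j\gamma_j|x}.$$
   Context: $\mathbb{D}=\{z\in\mathbb{C}:|z|<1\}$, and $\mathrm{H}(\mathbb{D})$ is the set of holomorphic functions $f$ on $\mathbb{D}$ with $|f|\le 1$. For $z,w\in\mathbb{D}$ put $[z,w]=\dfrac{z-w}{1-\overline{w}z}$, and put $[z,z]=0$ for $z\in\partial\mathbb{D}$. A (finite) Blaschke product of degree $n$ is a function $e^{i\theta}\prod_{j=1}^n[z,a_j]$ with $\theta\in\mathbb{R}$ and $a_1,\dots,a_n\in\mathbb{D}$; those of degree $0$ are the unimodular constants. For $f\in\mathrm{H}(\mathbb{D})$ and $z_0\in\mathbb{D}$ define $\Delta_{z_0}f\in\mathrm{H}(\mathbb{D})$ by $\Delta_{z_0}f(z)=\dfrac{[f(z),f(z_0)]}{[z,z_0]}$ for $z\neq z_0$ and $\Delta_{z_0}f(z_0)=\dfrac{(1-|z_0|^2)f'(z_0)}{1-|f(z_0)|^2}$ (if $f$ is a unimodular constant, $\Delta_{z_0}f\equiv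 0$). It is known from the Schwarz–Pick lemma that $\Delta_{z_0}$ maps $\mathrm{H}(\mathbb{D})$ into itself. For points $z_0,z_1,\dots\in\mathbb{D}$ (not necessarily distinct) define $f_j(z;z_{j-1},\dots,z_0)=(\Delta_{z_{j-1}}\circ\cdots\circ\Delta_{z_0})f(z)$, with $f_0(z)=f(z)$ for $j=0$. *)

theory Defs
  imports "HOL-Complex_Analysis.Complex_Analysis"
begin

text \<open>The open unit disc is \<^term>\<open>ball 0 1 :: complex set\<close>. Functions on the disc are
  total functions of which only the values on the disc matter.\<close>

definition schur_class :: "(complex \<Rightarrow> complex) set" where
  "schur_class = {f. f holomorphic_on ball 0 1 \<and> (\<forall>z\<in>ball 0 1. norm (f z) \<le> 1)}"

text \<open>The bracket \<open>[z, w]\<close>. The convention \<open>[z, z] = 0\<close> for \<open>z\<close> on the unit circle is the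
  instance \<open>0 / 0 = 0\<close> of division by zero.\<close>

definition bracket :: "complex \<Rightarrow> complex \<Rightarrow> complex" where
  "bracket z w = (z - w) / (1 - cnj w * z)"

lemma bracket_self: "bracket z z = 0"
  by (simp add: bracket_def)

definition blaschke_product :: "nat \<Rightarrow> (complex \<Rightarrow> complex) \<Rightarrow> bool" where
  "blaschke_product n f \<longleftrightarrow>
     (\<exists>(\<theta>::real) a. (\<forall>j\<in>{1..n}. a j \<in> ball 0 1) \<and>
        (\<forall>z\<in>ball 0 1. f z = exp (\<i> * of_real \<theta>) * (\<Prod>j=1..n. bracket z (a j))))"

definition hyp_quotient :: "complex \<Rightarrow> (complex \<Rightarrow> complex) \<Rightarrow> complex \<Rightarrow> complex" where
  "hyp_quotient z0 f z =
     (if z = z0 then of_real (1 - (norm z0)\<^sup>2) * deriv f z0 / of_real (1 - (norm (f z0))\<^sup>2)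
      else bracket (f z) (f z0) / bracket z z0)"

text \<open>For a unimodular constant the value at \<open>z0\<close> is again \<open>0 / 0 = 0\<close>, so the quotient vanishes
  identically on the disc, as required.\<close>

lemma hyp_quotient_const:
  assumes "z0 \<in> ball 0 1" "z \<in> ball 0 1" "norm c = 1" "\<And>w. w \<in> ball 0 1 \<Longrightarrow> f w = c"
  shows "hyp_quotient z0 f z = 0"
  using assms by (simp add: hyp_quotient_def bracket_self)

text \<open>\<open>schur_iter f z j\<close> is \<open>f\<^sub>j(\<cdot>; z\<^bsub>j-1\<^esub>, \<dots>, z\<^sub>0)\<close>.\<close>

primrec schur_iter ::
  "(complex \<Rightarrow> complex) \<Rightarrow> (nat \<Rightarrow> complex) \<Rightarrow> nat \<Rightarrow> complex \<Rightarrow> complex" where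
  "schur_iter f z 0 = f"
| "schur_iter f z (Suc j) = hyp_quotient (z j) (schur_iter f z j)"

text \<open>\<open>comp_upto T k\<close> is \<open>T\<^sub>0 \<circ> \<dots> \<circ> T\<^sub>k\<close>.\<close>

primrec comp_upto :: "(nat \<Rightarrow> 'a \<Rightarrow> 'a) \<Rightarrow> nat \<Rightarrow> 'a \<Rightarrow> 'a" where
  "comp_upto T 0 = T 0"
| "comp_upto T (Suc k) = comp_upto T k \<circ> T (Suc k)"

end

theory Submission
  imports Defs
begin

text \<open>The proof peels off one hyperbolic difference quotient at a time. Suppose that
  \<open>g\<close> is a Schur function, \<open>w \<in> \<D>\<close> and \<open>c = g w\<close>. By the definition of the quotient
  \<open>\<Delta> = hyp_quotient w g\<close>, the number \<open>[g a, c]\<close> is the product of \<open>[a, w]\<close> and \<open>\<Delta> a\<close>, so the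
  pseudohyperbolic distance from \<open>g a\<close> to \<open>c\<close> is \<open>p = |[a, w]| |\<Delta> a|\<close>. Among the points at that
  distance from \<open>c \<in> \<D>\<close>, the largest modulus is attained on the ray from \<open>0\<close> through \<open>c\<close>,
  which gives
  \<open>|g a| \<le> (p + |c|) / (1 + p |c|)\<close>
  (\<open>norm_le_of_norm_bracket\<close>, \<open>norm_le_hyp_quotient\<close>); if \<open>|c| = 1\<close>, the right-hand side is \<open>1\<close>. For
  \<open>g = f\<^sub>j\<close> and \<open>w = z\<^sub>j\<close> this says \<open>|f\<^sub>j a| \<le> T\<^sub>j |f\<^sub>j\<^sub>+\<^sub>1 a|\<close>.

  The inequalities can be chained because each \<open>T\<^sub>j\<close> is a nondecreasing self-map of \<open>[0, 1]\<close>
  (\<open>pick_map_mono\<close>, \<open>pick_map_in_unit\<close>) and because every \<open>f\<^sub>j\<close> is again a Schur function, which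
  is the Schwarz-Pick lemma (\<open>hyp_quotient_schur_class\<close>). Hence
  \<open>|f a| \<le> (T\<^sub>0 \<circ> \<dots> \<circ> T\<^sub>n) |f\<^sub>n\<^sub>+\<^sub>1 a| \<le> (T\<^sub>0 \<circ> \<dots> \<circ> T\<^sub>n) 1\<close>, and the remaining inequalities apply
  \<open>T\<^sub>0 \<circ> \<dots> \<circ> T\<^sub>k\<close> to \<open>T\<^sub>k\<^sub>+\<^sub>1 1 \<le> 1\<close>.\<close>

section \<open>The bracket\<close>

lemma bracket_eq_Moebius: "bracket z w = Moebius_function 0 w z"
  by (simp add: bracket_def Moebius_function_simple)

lemma one_minus_cnj_mult_nonzero:
  fixes w z :: complex
  assumes "norm w < 1" "norm z \<le> 1"
  shows "1 - cnj w * z \<noteq> 0"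
proof
  assume "1 - cnj w * z = 0"
  then have "norm w * norm z = 1"
    by (metis complex_mod_cnj eq_iff_diff_eq_0 norm_mult norm_one)
  moreover have "norm w * norm z \<le> norm w"
    using assms by (simp add: mult_left_le)
  ultimately show False using assms by simp
qed

lemma bracket_eq_0_iff:
  assumes "norm w < 1" "norm z \<le> 1"
  shows "bracket z w = 0 \<longleftrightarrow> z = w"
  using one_minus_cnj_mult_nonzero[OF assms] by (auto simp: bracket_def)

lemma has_field_derivative_bracket_self:
  assumes "norm w < 1"
  shows "((\<lambda>z. bracket z w) has_field_derivative 1 / of_real (1 - (norm w)\<^sup>2)) (at w)"
proof -
  have nz: "1 - cnj w * w \<noteq> 0"
    using one_minus_cnj_mult_nonzero assms by simp
  have eq: "of_real (1 - (norm w)\<^sup>2) = 1 - cnj w * w"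
    by (simp only: of_real_diff of_real_1 complex_norm_square mult.commute)
  show ?thesis
    unfolding bracket_def eq
    by (rule derivative_eq_intros refl nz | use nz in \<open>simp add: divide_simps\<close>)+
qed

lemma norm_square_diff_bracket:
  fixes b w :: complex
  shows "(norm (1 + cnj w * b))\<^sup>2 - (norm (b + w))\<^sup>2 = (1 - (norm b)\<^sup>2) * (1 - (norm w)\<^sup>2)"
  by (simp only: cmod_power2) (simp add: power2_eq_square algebra_simps)

text \<open>The quantities \<open>|1 + w\<^sup>* b|\<^sup>2 - |b + w|\<^sup>2\<close> and \<open>(1 + |b| |w|)\<^sup>2 - (|b| + |w|)\<^sup>2\<close> agree, both
  being \<open>(1 - |b|\<^sup>2) (1 - |w|\<^sup>2) \<ge> 0\<close>. As \<open>|1 + w\<^sup>* b| \<le> 1 + |b| |w|\<close>, subtracting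
  the same number from both squares lowers \<open>|1 + w\<^sup>* b|\<close> by the larger factor, so that
  \<open>|b + w| / |1 + w\<^sup>* b| \<le> (|b| + |w|) / (1 + |b| |w|)\<close>. The products avoid a case distinction
  on vanishing denominators.\<close>

lemma norm_moebius_le:
  fixes b w :: complex
  assumes "norm b \<le> 1" "norm w \<le> 1"
  shows "norm (b + w) * (1 + norm b * norm w) \<le> (norm b + norm w) * norm (1 + cnj w * b)"
proof (rule power2_le_imp_le)
  define D where "D = 1 + norm b * norm w"
  define S where "S = norm b + norm w"
  define N where "N = norm (1 + cnj w * b)"
  define K where "K = (1 - (norm b)\<^sup>2) * (1 - (norm w)\<^sup>2)"
  have "N \<le> D"
    unfolding N_def D_def by (metis norm_triangle_ineq complex_mod_cnj mult.commute norm_mult norm_one)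
  then have "N\<^sup>2 \<le> D\<^sup>2"
    by (simp add: N_def power_mono)
  moreover have "K \<ge> 0"
    unfolding K_def using assms by (simp add: power_le_one)
  ultimately have "K * N\<^sup>2 \<le> K * D\<^sup>2"
    by (simp add: mult_left_mono)
  moreover have "(norm (b + w))\<^sup>2 = N\<^sup>2 - K"
    using norm_square_diff_bracket[of w b] by (simp add: N_def K_def)
  moreover have "S\<^sup>2 = D\<^sup>2 - K"
    by (simp add: S_def D_def K_def power2_eq_square algebra_simps)
  ultimately have "(norm (b + w))\<^sup>2 * D\<^sup>2 \<le> S\<^sup>2 * N\<^sup>2"
    by (simp only: left_diff_distrib mult.commute[of "D\<^sup>2" "N\<^sup>2"])
  then show "(norm (b + w) * (1 + norm b * norm w))\<^sup>2 \<le> ((norm b + norm w) * norm (1 + cnj w * b))\<^sup>2"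
    by (simp add: power_mult_distrib D_def S_def N_def)
qed auto

text \<open>With \<open>b = [u, c]\<close> one has \<open>u = (b + c) / (1 + c\<^sup>* b)\<close>, so this is the previous lemma.\<close>

lemma norm_le_of_norm_bracket:
  assumes u: "norm u \<le> 1" and c: "norm c < 1" and b: "norm (bracket u c) \<le> 1"
  shows "norm u \<le> (norm (bracket u c) + norm c) / (1 + norm (bracket u c) * norm c)"
proof -
  define b where "b = bracket u c"
  have nz: "1 - cnj c * u \<noteq> 0"
    using one_minus_cnj_mult_nonzero c u by simp
  have "u * (1 + cnj c * b) = b + c"
    using nz by (simp add: b_def bracket_def field_simps)
  then have nu: "norm (b + c) = norm u * norm (1 + cnj c * b)"
    by (metis norm_mult)
  have "1 - cnj c * (- b) \<noteq> 0"
    using one_minus_cnj_mult_nonzero[of c "- b"] c b by (simp add: b_def)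
  then have pos: "norm (1 + cnj c * b) > 0"
    by simp
  have "norm u * (1 + norm b * norm c) * norm (1 + cnj c * b)
        \<le> (norm b + norm c) * norm (1 + cnj c * b)"
    using norm_moebius_le[of b c] b c nu by (simp add: b_def mult_ac)
  then have "norm u * (1 + norm b * norm c) \<le> norm b + norm c"
    using pos by simp
  moreover have "1 + norm b * norm c > 0"
    by (simp add: add_pos_nonneg)
  ultimately show ?thesis
    by (simp add: b_def pos_le_divide_eq)
qed

section \<open>Hyperbolic difference quotients of Schur functions\<close>

lemma schur_class_dichotomy:
  assumes "f \<in> schur_class"
  obtains (inner) "\<And>z. norm z < 1 \<Longrightarrow> norm (f z) < 1"
    | (const) c where "norm c = 1" "\<And>z. norm z < 1 \<Longrightarrow> f z = c"
proof (cases "\<exists>w. norm w < 1 \<and> norm (f w) = 1")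
  case False
  then have "norm (f z) < 1" if "norm z < 1" for z
    using assms that unfolding schur_class_def by (force simp: less_le)
  then show ?thesis using inner by blast
next
  case True
  then obtain w where w: "norm w < 1" "norm (f w) = 1" by blast
  have "f constant_on ball 0 1"
    using assms w unfolding schur_class_def
    by (intro maximum_modulus_principle[of f "ball 0 1" "ball 0 1" w]) auto
  then have "f z = f w" if "norm z < 1" for z
    using w that by (auto simp: constant_on_def)
  then show ?thesis using const[of "f w"] w by blast
qed

text \<open>In the coordinates \<open>\<zeta> = [z, z0]\<close> on the domain and \<open>[\<cdot>, f z0]\<close> on the range, \<open>f\<close> becomes a
  self-map \<open>F\<close> of the disc that fixes \<open>0\<close>. The Schwarz lemma gives \<open>F \<zeta> = \<zeta> h \<zeta>\<close> with
  \<open>|h| \<le> 1\<close>, and the hyperbolic quotient is \<open>h\<close> in the original coordinate.\<close>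

lemma hyp_quotient_factor:
  assumes z0: "norm z0 < 1" and holf: "f holomorphic_on ball 0 1"
    and f1: "\<And>z. norm z < 1 \<Longrightarrow> norm (f z) < 1"
  obtains h where "h holomorphic_on ball 0 1" "\<And>z. norm z < 1 \<Longrightarrow> norm (h z) \<le> 1"
    "\<And>z. norm z < 1 \<Longrightarrow> hyp_quotient z0 f z = h (bracket z z0)"
proof -
  define c where "c = f z0"
  have c: "norm c < 1" using f1 z0 by (simp add: c_def)
  define G where "G = (\<lambda>z. bracket (f z) c)"
  define F where "F = G \<circ> (\<lambda>z. bracket z (- z0))"
  have br1: "norm (bracket z w) < 1" if "norm z < 1" "norm w < 1" for z w
    using that Moebius_function_norm_lt_1 by (simp add: bracket_eq_Moebius)
  have brhol: "(\<lambda>z. bracket z w) holomorphic_on ball 0 1" if "norm w < 1" for w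
    using Moebius_function_holomorphic[OF that, of 0] by (simp add: bracket_eq_Moebius[abs_def])
  have holG: "G holomorphic_on ball 0 1"
    unfolding G_def using holomorphic_on_compose_gen[OF holf brhol[OF c]] f1
    by (auto simp: o_def image_subset_iff)
  have holF: "F holomorphic_on ball 0 1"
    unfolding F_def
    by (rule holomorphic_on_compose_gen[OF brhol holG]) (use z0 br1[of _ "- z0"] in auto)
  have F0: "F 0 = 0"
    by (simp add: F_def G_def c_def bracket_def)
  have F1: "norm (F z) < 1" if "norm z < 1" for z
    using that br1 f1 c z0 by (simp add: F_def G_def)
  obtain h where holh: "h holomorphic_on ball 0 1"
    and Fh: "\<And>z. norm z < 1 \<Longrightarrow> F z = z * h z" and h0: "deriv F 0 = h 0"
    using Schwarz3[OF holF F0] by blast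
  have h1: "norm (h z) \<le> 1" if z: "norm z < 1" for z
  proof (cases "z = 0")
    case True
    then show ?thesis using Schwarz_Lemma(2)[OF holF F0 F1 z] h0 by simp
  next
    case False
    have "norm z * norm (h z) \<le> norm z * 1"
      using Schwarz_Lemma(1)[OF holF F0 F1 z] Fh[OF z] by (simp add: norm_mult)
    then show ?thesis using False by (simp add: mult_le_cancel_left1)
  qed
  have Gh: "G z = bracket z z0 * h (bracket z z0)" if z: "norm z < 1" for z
  proof -
    have "bracket (bracket z z0) (- z0) = z"
      using Moebius_function_compose[of "- z0" z0 z] z0 z by (simp add: bracket_eq_Moebius)
    then have "G z = F (bracket z z0)" by (simp add: F_def)
    then show ?thesis using Fh br1 z z0 by simp
  qed
  have "hyp_quotient z0 f z = h (bracket z z0)" if z: "norm z < 1" for z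
  proof (cases "z = z0")
    case False
    then have "bracket z z0 \<noteq> 0" using bracket_eq_0_iff z0 z by simp
    then show ?thesis using Gh[OF z] False by (simp add: hyp_quotient_def G_def c_def)
  next
    case True
    \<comment> \<open>The value at the base point is found by differentiating both sides of \<open>Gh\<close> there.\<close>
    have "(f has_field_derivative deriv f z0) (at z0)"
      using holomorphic_derivI[OF holf] z0 by simp
    then have d1: "(G has_field_derivative 1 / of_real (1 - (norm c)\<^sup>2) * deriv f z0) (at z0)"
      unfolding G_def
      by (rule DERIV_chain2[where f="\<lambda>u. bracket u c", rotated])
         (use has_field_derivative_bracket_self[OF c] in \<open>simp add: c_def\<close>)
    have dh: "((\<lambda>z. h (bracket z z0)) has_field_derivative
        deriv h 0 * (1 / of_real (1 - (norm z0)\<^sup>2))) (at z0)"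
      by (rule DERIV_chain2[OF _ has_field_derivative_bracket_self[OF z0]])
         (use holomorphic_derivI[OF holh] in \<open>simp add: bracket_self\<close>)
    have "((\<lambda>z. bracket z z0 * h (bracket z z0)) has_field_derivative
        1 / of_real (1 - (norm z0)\<^sup>2) * h 0) (at z0)"
      using DERIV_mult[OF has_field_derivative_bracket_self[OF z0] dh]
      by (simp add: bracket_self)
    then have "(G has_field_derivative 1 / of_real (1 - (norm z0)\<^sup>2) * h 0) (at z0)"
      by (rule has_field_derivative_transform_within_open[of _ _ _ "ball 0 1"])
         (use z0 Gh in auto)
    from DERIV_unique[OF d1 this]
    have eq: "deriv f z0 / of_real (1 - (norm c)\<^sup>2) = h 0 / of_real (1 - (norm z0)\<^sup>2)"
      by simp
    have "(norm z0)\<^sup>2 < 1"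
      using z0 by (simp add: power_less_one_iff)
    then have nz: "complex_of_real (1 - (norm z0)\<^sup>2) \<noteq> 0"
      by (metis less_irrefl of_real_eq_0_iff right_minus_eq)
    have "hyp_quotient z0 f z0
        = of_real (1 - (norm z0)\<^sup>2) * (deriv f z0 / of_real (1 - (norm c)\<^sup>2))"
      by (simp add: hyp_quotient_def c_def)
    also have "\<dots> = h 0"
      unfolding eq using nz by simp
    finally show ?thesis using True by (simp add: bracket_self)
  qed
  with holh h1 show ?thesis using that by blast
qed

lemma hyp_quotient_schur_class:
  assumes "f \<in> schur_class" and z0: "norm z0 < 1"
  shows "hyp_quotient z0 f \<in> schur_class"
  using assms(1)
proof (cases rule: schur_class_dichotomy)
  case inner
  obtain h where holh: "h holomorphic_on ball 0 1"
    and h1: "\<And>z. norm z < 1 \<Longrightarrow> norm (h z) \<le> 1"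
    and eq: "\<And>z. norm z < 1 \<Longrightarrow> hyp_quotient z0 f z = h (bracket z z0)"
    using hyp_quotient_factor[of z0 f, OF z0 _ inner] assms(1)
    unfolding schur_class_def by blast
  have br1: "norm (bracket z z0) < 1" if "norm z < 1" for z
    using that z0 Moebius_function_norm_lt_1 by (simp add: bracket_eq_Moebius)
  have "(h \<circ> (\<lambda>z. bracket z z0)) holomorphic_on ball 0 1"
    by (rule holomorphic_on_compose_gen[OF _ holh])
       (use Moebius_function_holomorphic[OF z0, of 0] br1 in
         \<open>auto simp: bracket_eq_Moebius[abs_def]\<close>)
  then have "hyp_quotient z0 f holomorphic_on ball 0 1"
    by (rule holomorphic_transform) (simp add: eq)
  then show ?thesis using eq h1 br1 by (simp add: schur_class_def)
next
  case (const c)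
  have eq: "hyp_quotient z0 f z = 0" if "norm z < 1" for z
    using hyp_quotient_const[of z0 z c f] const z0 that by simp
  have "(\<lambda>z. 0) holomorphic_on ball 0 1" by simp
  then have "hyp_quotient z0 f holomorphic_on ball 0 1"
    by (rule holomorphic_transform) (simp add: eq)
  then show ?thesis using eq by (simp add: schur_class_def)
qed

lemma schur_iter_schur_class:
  assumes "f \<in> schur_class" "\<And>i. i < j \<Longrightarrow> norm (z i) < 1"
  shows "schur_iter f z j \<in> schur_class"
  using assms(2) by (induction j) (auto intro: assms(1) hyp_quotient_schur_class)

section \<open>The real maps and their composition\<close>

text \<open>In the theorem, \<open>T\<^sub>j\<close> is \<open>pick_map |\<tau>\<^sub>j| |\<gamma>\<^sub>j|\<close>.\<close>

definition pick_map :: "real \<Rightarrow> real \<Rightarrow> real \<Rightarrow> real" where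
  "pick_map t c x = (t * x + c) / (1 + t * c * x)"

lemma pick_map_in_unit:
  assumes "t \<in> {0..1}" "c \<in> {0..1}" "x \<in> {0..1}"
  shows "pick_map t c x \<in> {0..1}"
proof -
  have tx: "t * x \<le> 1" "0 \<le> t * x"
    using assms by (auto simp: mult_le_one)
  have "0 \<le> (1 - t * x) * (1 - c)"
    using tx assms by simp
  then have "t * x + c \<le> 1 + t * c * x"
    by (simp add: algebra_simps)
  moreover have "0 < 1 + t * c * x"
    using assms by (auto intro!: add_pos_nonneg)
  ultimately show ?thesis
    using tx assms by (simp add: pick_map_def)
qed

lemma pick_map_mono:
  assumes "t \<in> {0..1}" "c \<in> {0..1}" "0 \<le> x" "x \<le> y"
  shows "pick_map t c x \<le> pick_map t c y"
proof -
  have pos: "0 < 1 + t * c * x" "0 < 1 + t * c * y"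
    using assms by (auto intro!: add_pos_nonneg)
  have "c * c \<le> 1" using assms by (auto simp: mult_le_one)
  then have "0 \<le> t * (1 - c * c) * (y - x)"
    using assms by simp
  then have "(t * x + c) * (1 + t * c * y) \<le> (t * y + c) * (1 + t * c * x)"
    by (simp add: algebra_simps)
  then show ?thesis
    using pos by (simp add: pick_map_def frac_le_eq divide_simps)
qed

text \<open>If \<open>f\<close> has modulus \<open>1\<close> at \<open>w\<close>, the map on the right is constantly \<open>1\<close>, while at \<open>a = w\<close> it
  has the value \<open>|f w|\<close>. In all other cases \<open>[f a, f w] = [a, w] \<Delta>f(a)\<close> applies.\<close>

lemma norm_le_hyp_quotient:
  assumes f: "f \<in> schur_class" and a: "norm a < 1" and w: "norm w < 1"
  shows "norm (f a) \<le> pick_map (norm (bracket a w)) (norm (f w)) (norm (hyp_quotient w f a))"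
proof -
  have fa: "norm (f a) \<le> 1" and fw: "norm (f w) \<le> 1"
    using f a w by (auto simp: schur_class_def)
  have b1: "norm (bracket a w) \<le> 1"
    using Moebius_function_norm_lt_1[OF w a, of 0] by (simp add: bracket_eq_Moebius)
  have q1: "norm (hyp_quotient w f a) \<le> 1"
    using hyp_quotient_schur_class[OF f w] a by (simp add: schur_class_def)
  consider "a = w" | "norm (f w) = 1" | "a \<noteq> w" "norm (f w) < 1"
    using fw by linarith
  then show ?thesis
  proof cases
    case 1
    then show ?thesis by (simp add: pick_map_def bracket_self)
  next
    case 2
    have "0 < 1 + norm (bracket a w) * norm (hyp_quotient w f a)"
      by (simp add: add_pos_nonneg)
    then show ?thesis using fa 2 by (simp add: pick_map_def add.commute)
  next
    case 3
    have "bracket a w \<noteq> 0"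
      using 3 a w bracket_eq_0_iff by simp
    then have "bracket (f a) (f w) = bracket a w * hyp_quotient w f a"
      using 3 by (simp add: hyp_quotient_def)
    then have "norm (bracket (f a) (f w)) = norm (bracket a w) * norm (hyp_quotient w f a)"
      by (simp add: norm_mult)
    moreover from this have "norm (bracket (f a) (f w)) \<le> 1"
      using b1 q1 by (simp add: mult_le_one)
    ultimately show ?thesis
      using norm_le_of_norm_bracket[OF fa 3(2)] by (simp add: pick_map_def mult_ac)
  qed
qed

lemma comp_upto_mono:
  fixes T :: "nat \<Rightarrow> real \<Rightarrow> real"
  assumes "\<And>j x. j \<le> k \<Longrightarrow> x \<in> {0..1} \<Longrightarrow> T j x \<in> {0..1}"
    and "\<And>j x y. j \<le> k \<Longrightarrow> 0 \<le> x \<Longrightarrow> x \<le> y \<Longrightarrow> y \<le> 1 \<Longrightarrow> T j x \<le> T j y"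
    and "0 \<le> x" "x \<le> y" "y \<le> 1"
  shows "comp_upto T k x \<le> comp_upto T k y"
  using assms
proof (induction k arbitrary: x y)
  case 0
  then show ?case by simp
next
  case (Suc k)
  have "T (Suc k) x \<in> {0..1}" "T (Suc k) y \<in> {0..1}" "T (Suc k) x \<le> T (Suc k) y"
    using Suc.prems by auto
  then show ?case
    using Suc.IH[of "T (Suc k) x" "T (Suc k) y"] Suc.prems by auto
qed

section \<open>The chain of inequalities\<close>


theorem theorem2p7:
  fixes a :: complex and z :: "nat \<Rightarrow> complex" and n :: nat
    and f :: "complex \<Rightarrow> complex"
    and \<gamma> \<tau> :: "nat \<Rightarrow> complex" and T :: "nat \<Rightarrow> real \<Rightarrow> real"
  assumes "a \<in> ball 0 1"
    and "\<And>j. j \<le> n \<Longrightarrow> z j \<in> ball 0 1"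
    and "f \<in> schur_class"
    and "\<not> (\<exists>m\<le>n. blaschke_product m f)"
    and "\<And>j. j \<le> n \<Longrightarrow> \<gamma> j = schur_iter f z j (z j)"
    and "\<And>j. j \<le> n \<Longrightarrow> \<tau> j = bracket a (z j)"
    and "\<And>j x. j \<le> n \<Longrightarrow>
           T j x = (norm (\<tau> j) * x + norm (\<gamma> j)) / (1 + norm (\<tau> j * \<gamma> j) * x)"
  shows "norm (f a) \<le> comp_upto T n 1 \<and>
         (\<forall>k<n. comp_upto T (Suc k) 1 \<le> comp_upto T k 1)"
proof -
  have a: "norm a < 1" and z: "\<And>j. j \<le> n \<Longrightarrow> norm (z j) < 1"
    using assms(1,2) by auto
  have schur: "schur_iter f z j \<in> schur_class" if "j \<le> Suc n" for j
    using schur_iter_schur_class[OF assms(3)] z that by simp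
  have val: "norm (schur_iter f z j w) \<in> {0..1}" if "j \<le> Suc n" "norm w < 1" for j w
    using schur[OF that(1)] that(2) by (simp add: schur_class_def)
  have \<tau>: "norm (\<tau> j) \<in> {0..1}" if "j \<le> n" for j
    using Moebius_function_norm_lt_1[OF z[OF that] a, of 0] assms(6)[OF that]
    by (simp add: bracket_eq_Moebius)
  have \<gamma>: "norm (\<gamma> j) \<in> {0..1}" if "j \<le> n" for j
    using assms(5) val z that by simp
  have T: "T j = pick_map (norm (\<tau> j)) (norm (\<gamma> j))" if "j \<le> n" for j
    using assms(7)[OF that] by (simp add: fun_eq_iff pick_map_def norm_mult)
  have T_unit: "T j x \<in> {0..1}" if "j \<le> n" "x \<in> {0..1}" for j x
    unfolding T[OF that(1)] using pick_map_in_unit \<tau> \<gamma> that by blast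
  have T_mono: "T j x \<le> T j y" if "j \<le> n" "0 \<le> x" "x \<le> y" for j x y
    unfolding T[OF that(1)] using pick_map_mono \<tau> \<gamma> that by blast
  have comp_mono: "comp_upto T k x \<le> comp_upto T k y"
    if "k \<le> n" "0 \<le> x" "x \<le> y" "y \<le> 1" for k x y
    by (rule comp_upto_mono) (use T_unit T_mono that in auto)
  have step: "norm (schur_iter f z j a) \<le> T j (norm (schur_iter f z (Suc j) a))" if "j \<le> n" for j
    using norm_le_hyp_quotient[OF schur a z] that assms(5,6) by (simp add: T)
  have "norm (f a) \<le> comp_upto T k (norm (schur_iter f z (Suc k) a))" if "k \<le> n" for k
    using that
  proof (induction k)
    case 0
    then show ?case using step[of 0] by simp
  next
    case (Suc k)
    have "norm (f a) \<le> comp_upto T k (norm (schur_iter f z (Suc k) a))"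
      using Suc by simp
    also have "\<dots> \<le> comp_upto T k (T (Suc k) (norm (schur_iter f z (Suc (Suc k)) a)))"
    proof (rule comp_mono)
      show "T (Suc k) (norm (schur_iter f z (Suc (Suc k)) a)) \<le> 1"
        using T_unit[OF Suc.prems] val[of "Suc (Suc k)" a] Suc.prems a
        by (meson Suc_le_mono atLeastAtMost_iff)
    qed (use Suc.prems step[OF Suc.prems] in simp_all)
    finally show ?case by simp
  qed
  from this[of n] have "norm (f a) \<le> comp_upto T n (norm (schur_iter f z (Suc n) a))"
    by simp
  also have "\<dots> \<le> comp_upto T n 1"
    using val[of "Suc n" a] a by (intro comp_mono) auto
  finally have "norm (f a) \<le> comp_upto T n 1" .
  moreover have "comp_upto T (Suc k) 1 \<le> comp_upto T k 1" if "k < n" for k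
  proof -
    have "T (Suc k) 1 \<in> {0..1}"
      using T_unit that by simp
    then show ?thesis
      using comp_mono[of k "T (Suc k) 1" 1] that by simp
  qed
  ultimately show ?thesis by blast
qed

end
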